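(* Let $Y$ be a real random variable whose moment generating function $E[e^{tY}]$ exists for $|t|<\rho$ for some $\rho>0$. For every integer $n\ge 0$ and every real $x$, $$\phi_{n}^{Y}(1-x)= \sum_{l=0}^{n}\sum_{k=0}^{l}\binom{n}{l}{l \brace k}_{Y}D_{k}(x)(-1)^{k}E[Y^{n-l}].$$
   Context: The derangement polynomials $D_n(x)$ are defined by $$\frac{e^{xt}}{1-t}e^{-t}=\sum_{n=0}^{\infty}D_{n}(x)\frac{t^{n}}{n!}.$$ The probabilistic Stirling numbers of the second kind associated with $Y$, denoted ${n \brace k}_Y$, are defined for $n\ge k\ge 0$ by $$\frac{1}{k!}\big(E[e^{tY}]-1\big)^{k}=\sum_{n=k}^{\infty}{n \brace k}_{Y}\frac{t^{n}}{n!};$$ equivalently ${n \brace k}_{Y}=\frac{1}{k!}\sum_{j=0}^{k}\binom{k}{j}(-1)^{k-j}E[S_{j}^{n}]$, where $S_0=0$, $S_j=Y_1+\cdots+Y_j$ and $(Y_j)_{j\ge1}$ are mutually independent copies of $Y$ (with $0^0=1$). The probabilistic Bell polynomials associated with $Y$ are $$\phi_{n}^{Y}(x)=\sum_{k=0}^{n}{n \brace k}_{Y}x^{k},\quad n\ge 0.$$ *)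

theory Defs
  imports "HOL-Probability.Probability"
begin

definition derangement_poly :: "nat \<Rightarrow> real \<Rightarrow> real" where
  "derangement_poly n x =
     fact n * fps_nth (fps_exp x / (1 - fps_X) * fps_exp (- 1)) n"

context prob_space
begin

definition mgf :: "('a \<Rightarrow> real) \<Rightarrow> real \<Rightarrow> real" where
  "mgf Y t = expectation (\<lambda>\<omega>. exp (t * Y \<omega>))"

text \<open>
  The generating function \<open>(mgf Y t - 1) ^ k / k!\<close> is an analytic function of the real variable
  \<open>t\<close> near 0, so its power series is taken in the sense of convergence in a neighbourhood of 0.
  Existence and uniqueness of that series, and the vanishing of the coefficients with
  \<open>n < k\<close>, are shown in \<open>prob_stirling2_welldefined\<close> and \<open>prob_stirling2_eq_0\<close> below.
\<close>

definition prob_stirling2 :: "('a \<Rightarrow> real) \<Rightarrow> nat \<Rightarrow> nat \<Rightarrow> real" where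
  "prob_stirling2 Y n k =
     fact n * fps_nth (THE F. (\<lambda>t. (1 / fact k) * (mgf Y t - 1) ^ k) has_fps_expansion F) n"

definition prob_bell_poly :: "('a \<Rightarrow> real) \<Rightarrow> nat \<Rightarrow> real \<Rightarrow> real" where
  "prob_bell_poly Y n x = (\<Sum>k\<le>n. prob_stirling2 Y n k * x ^ k)"

end

lemma has_fps_expansion_unique_real:
  fixes f :: "real \<Rightarrow> real"
  assumes "f has_fps_expansion F" "f has_fps_expansion G"
  shows "F = G"
proof -
  have "fps_nth F n = fps_nth G n" for n
    using assms
  proof (induction n arbitrary: f F G)
    case 0
    then have "eval_fps F 0 = f 0" "eval_fps G 0 = f 0"
      by (auto simp: has_fps_expansion_def dest: eventually_nhds_x_imp_x)
    then show ?case by (simp add: eval_fps_at_0)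
  next
    case (Suc n)
    have "fps_nth (fps_deriv F) n = fps_nth (fps_deriv G) n"
      using Suc.prems by (intro Suc.IH[of "deriv f"] has_fps_expansion_deriv)
    then show ?case by simp
  qed
  then show ?thesis by (simp add: fps_eq_iff)
qed

context prob_space
begin

lemma mgf_sums:
  assumes Y: "random_variable borel Y"
    and mgf: "\<And>t. \<bar>t\<bar> < \<rho> \<Longrightarrow> integrable M (\<lambda>\<omega>. exp (t * Y \<omega>))"
    and t: "\<bar>t\<bar> < \<rho>"
  shows "(\<lambda>n. expectation (\<lambda>\<omega>. Y \<omega> ^ n) / fact n * t ^ n) sums mgf Y t"
proof -
  define f where "f n \<omega> = (t * Y \<omega>) ^ n / fact n" for n \<omega>
  have meas [measurable]: "f n \<in> borel_measurable M" for n
    unfolding f_def using Y by measurable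
  have int_abs: "integrable M (\<lambda>\<omega>. exp \<bar>t * Y \<omega>\<bar>)"
  proof (rule Bochner_Integration.integrable_bound)
    show "integrable M (\<lambda>\<omega>. exp (t * Y \<omega>) + exp (- t * Y \<omega>))"
      using mgf[of t] mgf[of "- t"] t by auto
    show "(\<lambda>\<omega>. exp \<bar>t * Y \<omega>\<bar>) \<in> borel_measurable M"
      using Y by measurable
    have "exp \<bar>x\<bar> \<le> exp x + exp (- x)" for x :: real
      by (cases "x \<ge> 0") auto
    then show "AE \<omega> in M. norm (exp \<bar>t * Y \<omega>\<bar>) \<le> norm (exp (t * Y \<omega>) + exp (- t * Y \<omega>))"
      by (intro AE_I2) (smt (verit) exp_gt_zero minus_mult_left real_norm_def)
  qed
  have expsums: "(\<lambda>n. x ^ n / fact n) sums exp x" for x :: real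
    using exp_converges[of x] by (simp add: scaleR_conv_of_real field_simps)
  have absum: "(\<lambda>n. norm (f n \<omega>)) sums exp \<bar>t * Y \<omega>\<bar>" for \<omega>
    using expsums[of "\<bar>t * Y \<omega>\<bar>"] by (simp add: f_def power_abs abs_mult)
  have fint: "integrable M (f n)" for n
  proof (rule Bochner_Integration.integrable_bound[OF int_abs meas AE_I2])
    fix \<omega>
    have "norm (f n \<omega>) \<le> exp \<bar>t * Y \<omega>\<bar>"
      using sum_le_suminf[of "\<lambda>n. norm (f n \<omega>)" "{n}"] absum[of \<omega>]
      by (simp add: sums_iff)
    then show "norm (f n \<omega>) \<le> norm (exp \<bar>t * Y \<omega>\<bar>)" by simp
  qed
  have bnd: "(\<Sum>n<N. norm (f n \<omega>)) \<le> exp \<bar>t * Y \<omega>\<bar>" for N \<omega>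
    using sum_le_suminf[of "\<lambda>n. norm (f n \<omega>)" "{..<N}"] absum[of \<omega>]
    by (simp add: sums_iff)
  have "summable (\<lambda>n. \<integral>\<omega>. norm (f n \<omega>) \<partial>M)"
  proof (rule bounded_imp_summable)
    show "0 \<le> (\<integral>\<omega>. norm (f n \<omega>) \<partial>M)" for n by simp
    show "(\<Sum>n\<le>N. \<integral>\<omega>. norm (f n \<omega>) \<partial>M) \<le> (\<integral>\<omega>. exp \<bar>t * Y \<omega>\<bar> \<partial>M)" for N
    proof -
      have "(\<Sum>n\<le>N. \<integral>\<omega>. norm (f n \<omega>) \<partial>M) = (\<integral>\<omega>. (\<Sum>n\<le>N. norm (f n \<omega>)) \<partial>M)"
        by (rule Bochner_Integration.integral_sum[symmetric]) (use fint in auto)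
      also have "\<dots> \<le> (\<integral>\<omega>. exp \<bar>t * Y \<omega>\<bar> \<partial>M)"
        using bnd[of _ "Suc N"] fint int_abs
        by (intro integral_mono) (auto simp: lessThan_Suc_atMost)
      finally show ?thesis .
    qed
  qed
  then have "(\<lambda>n. \<integral>\<omega>. f n \<omega> \<partial>M) sums (\<integral>\<omega>. (\<Sum>n. f n \<omega>) \<partial>M)"
    using fint absum by (intro sums_integral) (auto simp: sums_iff)
  moreover have "(\<Sum>n. f n \<omega>) = exp (t * Y \<omega>)" for \<omega>
    using expsums[of "t * Y \<omega>"] by (simp add: f_def sums_iff)
  moreover have "(\<integral>\<omega>. f n \<omega> \<partial>M) = expectation (\<lambda>\<omega>. Y \<omega> ^ n) / fact n * t ^ n" for n
    by (simp add: f_def power_mult_distrib)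
  ultimately show ?thesis
    by (simp add: mgf_def)
qed

lemma mgf_has_fps_expansion:
  assumes Y: "random_variable borel Y" and \<rho>: "\<rho> > 0"
    and mgf: "\<And>t. \<bar>t\<bar> < \<rho> \<Longrightarrow> integrable M (\<lambda>\<omega>. exp (t * Y \<omega>))"
  shows "mgf Y has_fps_expansion Abs_fps (\<lambda>n. expectation (\<lambda>\<omega>. Y \<omega> ^ n) / fact n)"
    (is "_ has_fps_expansion ?F")
  unfolding has_fps_expansion_def
proof
  have "norm (\<rho> / 2) \<le> fps_conv_radius ?F"
    unfolding fps_conv_radius_def using mgf_sums[OF Y mgf, of \<rho> "\<rho> / 2"] \<rho>
    by (intro conv_radius_geI) (auto simp: sums_iff)
  then show "0 < fps_conv_radius ?F"
    using \<rho> by (smt (verit) ereal_less(2) field_sum_of_halves norm_ge_zero order_less_le_trans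
        real_norm_def)
  have "eventually (\<lambda>t. t \<in> ball 0 \<rho>) (nhds (0 :: real))"
    using \<rho> by (intro eventually_nhds_in_open) auto
  then show "eventually (\<lambda>t. eval_fps ?F t = mgf Y t) (nhds 0)"
    by eventually_elim (use mgf_sums[OF Y mgf, of \<rho>] in \<open>auto simp: eval_fps_def sums_iff\<close>)
qed

lemma prob_stirling2_expansion:
  assumes "random_variable borel Y" "\<rho> > 0"
    and "\<And>t. \<bar>t\<bar> < \<rho> \<Longrightarrow> integrable M (\<lambda>\<omega>. exp (t * Y \<omega>))"
  shows "(\<lambda>t. (1 / fact k) * (mgf Y t - 1) ^ k) has_fps_expansion
           fps_const (1 / fact k) * (Abs_fps (\<lambda>n. expectation (\<lambda>\<omega>. Y \<omega> ^ n) / fact n) - 1) ^ k"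
proof -
  have "(\<lambda>t. (mgf Y t - 1) ^ k) has_fps_expansion
          (Abs_fps (\<lambda>n. expectation (\<lambda>\<omega>. Y \<omega> ^ n) / fact n) - 1) ^ k"
  proof (induction k)
    case 0
    then show ?case by simp
  next
    case (Suc k)
    have "(\<lambda>t. mgf Y t - 1) has_fps_expansion
            (Abs_fps (\<lambda>n. expectation (\<lambda>\<omega>. Y \<omega> ^ n) / fact n) - 1)"
      by (rule has_fps_expansion_diff[OF mgf_has_fps_expansion[OF assms] has_fps_expansion_1])
    from has_fps_expansion_mult[OF this Suc] show ?case by simp
  qed
  then show ?thesis by (rule has_fps_expansion_cmult_left)
qed

lemma prob_stirling2_welldefined:
  assumes "random_variable borel Y" "\<rho> > 0"
    and "\<And>t. \<bar>t\<bar> < \<rho> \<Longrightarrow> integrable M (\<lambda>\<omega>. exp (t * Y \<omega>))"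
  shows "\<exists>!F. (\<lambda>t. (1 / fact k) * (mgf Y t - 1) ^ k) has_fps_expansion F"
  using prob_stirling2_expansion[OF assms] has_fps_expansion_unique_real by blast

lemma prob_stirling2_eq_0:
  assumes "random_variable borel Y" "\<rho> > 0"
    and "\<And>t. \<bar>t\<bar> < \<rho> \<Longrightarrow> integrable M (\<lambda>\<omega>. exp (t * Y \<omega>))"
    and "n < k"
  shows "prob_stirling2 Y n k = 0"
proof -
  let ?F = "Abs_fps (\<lambda>n. expectation (\<lambda>\<omega>. Y \<omega> ^ n) / fact n) - 1 :: real fps"
  have "fps_nth ?F 0 = 0" by (simp add: prob_space)
  then have "fps_nth (?F ^ k) n = 0"
    using \<open>n < k\<close> startsby_zero_power_prefix by blast
  then show ?thesis
    using the1_equality[OF prob_stirling2_welldefined prob_stirling2_expansion, OF assms(1-3) assms(1-3)]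
    by (simp add: prob_stirling2_def)
qed

end

end

theory Submission
  imports Defs
begin

text \<open>
  Write \<open>F\<close> for the power series of the moment generating function and \<open>G = F - 1\<close>, which has no
  constant term, so that other power series can be composed with \<open>G\<close> and \<open>- G\<close>.  The numbers
  \<open>prob_stirling2 Y n k\<close> are the coefficients of \<open>G ^ k\<close>, up to factorials.  Hence the Bell
  polynomials at \<open>1 - x\<close> have the exponential generating function \<open>exp ((1 - x) G)\<close>, and the inner
  sum over \<open>k\<close> has the one that arises from the generating function of the derangement polynomials,
  \<open>D(t) = exp ((x - 1) t) / (1 - t)\<close>, when \<open>- G\<close> is substituted for \<open>t\<close>.  This substitution
  turns the denominator into \<open>1 + G = F\<close>, so that
  \[ \exp ((1 - x) G) = D(- G) \cdot F, \]
  which is \<open>derangement_fps_compose_uminus\<close>.  The theorem compares the coefficients of both sides: the product with \<open>F\<close>, whose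
  coefficients are the moments divided by factorials, is the binomial convolution over \<open>l\<close>.
\<close>

context prob_space
begin

definition moment_fps :: "('a \<Rightarrow> real) \<Rightarrow> real fps" where
  "moment_fps Y = Abs_fps (\<lambda>n. expectation (\<lambda>\<omega>. Y \<omega> ^ n) / fact n)"

lemma moment_fps_minus_1_nth_0: "fps_nth (moment_fps Y - 1) 0 = 0"
  by (simp add: moment_fps_def prob_space)

text \<open>
  The analytic hypothesis enters the proof only here: it identifies the convergent expansion in the
  definition of the Stirling numbers with a formal power of \<open>moment_fps Y - 1\<close>.
\<close>

lemma prob_stirling2_eq_fps_nth:
  assumes "random_variable borel Y" "\<rho> > 0"
    and "\<And>t. \<bar>t\<bar> < \<rho> \<Longrightarrow> integrable M (\<lambda>\<omega>. exp (t * Y \<omega>))"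
  shows "prob_stirling2 Y n k = fact n / fact k * fps_nth ((moment_fps Y - 1) ^ k) n"
  using the1_equality[OF prob_stirling2_welldefined prob_stirling2_expansion,
      OF assms(1-3) assms(1-3), of k]
  by (simp add: prob_stirling2_def moment_fps_def)

end

lemma fps_compose_uminus_right_nth:
  fixes A G :: "'a::comm_ring_1 fps"
  shows "fps_nth (A oo - G) n = (\<Sum>k=0..n. fps_nth A k * (- 1) ^ k * fps_nth (G ^ k) n)"
proof -
  have "fps_nth ((- G) ^ k) n = (- 1) ^ k * fps_nth (G ^ k) n" for k
    by (cases "even k") auto
  then show ?thesis by (simp add: fps_compose_nth mult.assoc)
qed

definition derangement_fps :: "real \<Rightarrow> real fps" where
  "derangement_fps x = fps_exp x / (1 - fps_X) * fps_exp (- 1)"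

lemma derangement_fps_mult: "derangement_fps x * (1 - fps_X) = fps_exp (x - 1)"
proof -
  have "fps_exp x / (1 - fps_X) * (1 - fps_X) = fps_exp x"
    by (simp add: fps_divide_unit mult.assoc inverse_mult_eq_1)
  then have "derangement_fps x * (1 - fps_X) = fps_exp x * fps_exp (- 1)"
    by (simp add: derangement_fps_def mult_ac)
  then show ?thesis by (simp add: fps_exp_add_mult[symmetric])
qed

text \<open>
  Composition with a series without constant term is multiplicative, so the equation
  \<open>derangement_fps_mult\<close> survives the substitution of \<open>- G\<close> for the indeterminate.  The right-hand
  side stays in composed form because its coefficients are then immediate from
  \<open>fps_compose_uminus_right_nth\<close>; it is the series \<open>exp ((1 - x) G)\<close>.
\<close>

lemma derangement_fps_compose_uminus:
  assumes "fps_nth G 0 = 0"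
  shows "(derangement_fps x oo - G) * (1 + G) = fps_exp (x - 1) oo - G"
proof -
  have "fps_exp (x - 1) oo - G = (derangement_fps x oo - G) * ((1 - fps_X) oo - G)"
    unfolding derangement_fps_mult[symmetric] using assms by (intro fps_compose_mult_distrib) simp
  moreover have "(1 - fps_X) oo - G = 1 + G"
    using assms by (simp add: fps_compose_sub_distrib)
  ultimately show ?thesis by simp
qed

theorem theorem2p3:
  fixes M :: "'a measure" and Y :: "'a \<Rightarrow> real" and \<rho> :: real and n :: nat and x :: real
  assumes "prob_space M"
    and "Y \<in> borel_measurable M"
    and "\<rho> > 0"
    and "\<And>t. \<bar>t\<bar> < \<rho> \<Longrightarrow> integrable M (\<lambda>\<omega>. exp (t * Y \<omega>))"
  shows "prob_space.prob_bell_poly M Y n (1 - x) =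
    (\<Sum>l=0..n. \<Sum>k=0..l. real (n choose l) * prob_space.prob_stirling2 M Y l k
        * derangement_poly k x * (- 1) ^ k * (\<integral>\<omega>. Y \<omega> ^ (n - l) \<partial>M))"
proof -
  interpret prob_space M by fact
  define G where "G = moment_fps Y - 1"
  have G0: "fps_nth G 0 = 0"
    by (simp only: G_def moment_fps_minus_1_nth_0)
  have S: "prob_stirling2 Y m k = fact m / fact k * fps_nth (G ^ k) m" for m k
    unfolding G_def by (rule prob_stirling2_eq_fps_nth) (use assms in auto)
  have inner: "(\<Sum>k=0..l. prob_stirling2 Y l k * derangement_poly k x * (- 1) ^ k) =
      fact l * fps_nth (derangement_fps x oo - G) l" for l
    by (simp add: S fps_compose_uminus_right_nth derangement_poly_def derangement_fps_def
        sum_distrib_left mult_ac)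
  have sign: "(x - 1) ^ k * (- 1) ^ k = (1 - x) ^ k" for k
    by (simp add: power_mult_distrib[symmetric])
  have "prob_bell_poly Y n (1 - x) = fact n * fps_nth (fps_exp (x - 1) oo - G) n"
    by (simp add: prob_bell_poly_def S fps_compose_uminus_right_nth sum_distrib_left
        sign[symmetric] atMost_atLeast0 mult_ac)
  also have "fps_exp (x - 1) oo - G = (derangement_fps x oo - G) * moment_fps Y"
    using derangement_fps_compose_uminus[OF G0, of x] by (simp add: G_def)
  also have "fact n * fps_nth \<dots> n =
      (\<Sum>l=0..n. real (n choose l) * (fact l * fps_nth (derangement_fps x oo - G) l)
        * expectation (\<lambda>\<omega>. Y \<omega> ^ (n - l)))"
    unfolding fps_mult_nth sum_distrib_left
    by (intro sum.cong refl) (simp add: moment_fps_def binomial_fact)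
  also have "\<dots> = (\<Sum>l=0..n. \<Sum>k=0..l. real (n choose l) * prob_stirling2 Y l k
        * derangement_poly k x * (- 1) ^ k * expectation (\<lambda>\<omega>. Y \<omega> ^ (n - l)))"
    unfolding inner[symmetric] by (simp add: sum_distrib_left sum_distrib_right mult.assoc)
  finally show ?thesis .
qed

end
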